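(* Let $G$ be a connected simply connected nilpotent Lie group and let $B$ be a magnetic field on $G$, i.e. a (smooth) closed $2$-form on $G$. Then $$\gamma^B(q;x,y):=e^{\,i\,\Gamma^B\langle\!\langle q,\,x^{-1}q,\,y^{-1}x^{-1}q\rangle\!\rangle},\qquad q,x,y\in G,$$ defines a $2$-cocycle of $G$ with values in $C(G;\mathbb T)$ (via $[\gamma^B(x,y)](q)=\gamma^B(q;x,y)$), satisfying the extra condition $$\gamma^B(x^{-1},x)=1=\gamma^B(x,x^{-1}),\qquad\forall\,x\in G .$$
   Context: $\mathfrak g$ is the Lie algebra of $G$; $\exp:\mathfrak g\to G$ is a diffeomorphism with inverse $\log$. Differential forms on $G$ are described in the global chart $\log$: a $2$-form $B$ on $G$ is seen as a smooth map sending $x\in G$ to a skew-symmetric bilinear form $B(x):\mathfrak g\times\mathfrak g\to\mathbb R$, in such a way that $B\circ\exp$ is the corresponding $2$-form on the vector space $\mathfrak g$ (so $B$ closed means that $B\circ\exp$ is a closed $2$-form on $\mathfrak g$). For $x,y,z\in G$ and $t,s\in\mathbb R$ set $$\langle x,y,z\rangle_{t,s}:=\exp\big[\log x+t(\log y-\log x)+s(\log z-\log y)\big]$$ and define the flux $$\Gamma^B\langle\!\langle x,y,z\rangle\!\rangle:=\int_0^1 dt\int_0^t ds\;B\big(\langle x,y,z\rangle_{t,s}\big)\big(\log x-\log y,\ \log x-\log z\big).$$ $C(G;\mathbb T)$ is the group of continuous functions $G\to\mathbb T$ with pointwise multiplication and the topology of uniform convergence on compact sets, on which $G$ acts by left translations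 $[\mathsf L_x(c)](q)=c(x^{-1}q)$. A $2$-cocycle of $G$ with values in $C(G;\mathbb T)$ is a continuous map $\gamma:G\times G\to C(G;\mathbb T)$ (equivalently, a continuous map $\gamma:G\times G\times G\to\mathbb T$, $\gamma(q;x,y)=[\gamma(x,y)](q)$) with $\gamma(x,y)\,\gamma(xy,z)=\mathsf L_x[\gamma(y,z)]\,\gamma(x,yz)$ for all $x,y,z\in G$, i.e. $\gamma(q;x,y)\gamma(q;xy,z)=\gamma(x^{-1}q;y,z)\gamma(q;x,yz)$ for all $q,x,y,z\in G$. *)

theory Defs
  imports "HOL-Analysis.Analysis" "HOL-Algebra.Generated_Groups"
begin

section \<open>Smooth maps and smooth manifolds\<close>

text \<open>\<open>C\<^sup>k\<close> and \<open>C\<^sup>\<infinity>\<close> maps on an open subset \<open>S\<close> of a finite-dimensional normed space. Finite dimension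
  is what makes the recursion over directional derivatives the usual notion. (\<open>euclidean_space\<close> is
  avoided because it excludes dimension zero.)\<close>

fun Ck_on :: "nat \<Rightarrow> 'a::real_normed_vector set \<Rightarrow> ('a \<Rightarrow> 'b::real_normed_vector) \<Rightarrow> bool" where
  "Ck_on 0 S f \<longleftrightarrow> continuous_on S f"
| "Ck_on (Suc k) S f \<longleftrightarrow>
     (\<forall>x\<in>S. f differentiable (at x)) \<and> (\<forall>v. Ck_on k S (\<lambda>x. frechet_derivative f (at x) v))"

definition smooth_on :: "'a::real_normed_vector set \<Rightarrow> ('a \<Rightarrow> 'b::real_normed_vector) \<Rightarrow> bool" where
  "smooth_on S f \<longleftrightarrow> (\<forall>k. Ck_on k S f)"

text \<open>A chart is a pair of its domain and its coordinate map; an atlas is a set of charts, not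
  required to be maximal.\<close>

type_synonym ('p, 'e) atlas = "('p set \<times> ('p \<Rightarrow> 'e)) set"

definition is_chart :: "'p::topological_space set \<Rightarrow> 'p set \<Rightarrow> ('p \<Rightarrow> 'e::real_normed_vector) \<Rightarrow> bool" where
  "is_chart M U \<phi> \<longleftrightarrow> openin (top_of_set M) U \<and> open (\<phi> ` U) \<and>
     homeomorphism U (\<phi> ` U) \<phi> (inv_into U \<phi>)"

definition smooth_manifold :: "'p::topological_space set \<Rightarrow> ('p, 'e::real_normed_vector) atlas \<Rightarrow> bool" where
  "smooth_manifold M A \<longleftrightarrow>
     (\<exists>Bs :: 'e set. finite Bs \<and> span Bs = UNIV) \<and>
     Hausdorff_space (top_of_set M) \<and> second_countable (top_of_set M) \<and>
     (\<forall>(U, \<phi>)\<in>A. is_chart M U \<phi>) \<and> (\<Union>(U, \<phi>)\<in>A. U) = M \<and>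
     (\<forall>(U, \<phi>)\<in>A. \<forall>(V, \<psi>)\<in>A. smooth_on (\<phi> ` (U \<inter> V)) (\<psi> \<circ> inv_into U \<phi>))"

definition smooth_map ::
  "'p::topological_space set \<Rightarrow> ('p, 'e::real_normed_vector) atlas \<Rightarrow>
   'q::topological_space set \<Rightarrow> ('q, 'f::real_normed_vector) atlas \<Rightarrow> ('p \<Rightarrow> 'q) \<Rightarrow> bool" where
  "smooth_map M A N A' F \<longleftrightarrow> continuous_on M F \<and> F ` M \<subseteq> N \<and>
     (\<forall>(U, \<phi>)\<in>A. \<forall>(V, \<psi>)\<in>A'. smooth_on (\<phi> ` (U \<inter> F -` V)) (\<psi> \<circ> F \<circ> inv_into U \<phi>))"

definition std_atlas :: "('e, 'e::real_normed_vector) atlas" where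
  "std_atlas = {(UNIV, \<lambda>x. x)}"

definition prod_atlas :: "('p, 'e) atlas \<Rightarrow> ('q, 'f) atlas \<Rightarrow> ('p \<times> 'q, 'e \<times> 'f) atlas" where
  "prod_atlas A A' = {(U \<times> V, \<lambda>(x, y). (\<phi> x, \<psi> y)) | U \<phi> V \<psi>. (U, \<phi>) \<in> A \<and> (V, \<psi>) \<in> A'}"

definition diffeomorphism ::
  "'p::topological_space set \<Rightarrow> ('p, 'e::real_normed_vector) atlas \<Rightarrow>
   'q::topological_space set \<Rightarrow> ('q, 'f::real_normed_vector) atlas \<Rightarrow> ('p \<Rightarrow> 'q) \<Rightarrow> bool" where
  "diffeomorphism M A N A' F \<longleftrightarrow>
     bij_betw F M N \<and> smooth_map M A N A' F \<and> smooth_map N A' M A (inv_into M F)"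

section \<open>Nilpotent Lie groups, Lie algebra and exponential map\<close>

definition lie_group :: "('g::topological_space, 'm) monoid_scheme \<Rightarrow> ('g, 'e::real_normed_vector) atlas \<Rightarrow> bool" where
  "lie_group G A \<longleftrightarrow> group G \<and> smooth_manifold (carrier G) A \<and>
     smooth_map (carrier G \<times> carrier G) (prod_atlas A A) (carrier G) A (\<lambda>(x, y). x \<otimes>\<^bsub>G\<^esub> y) \<and>
     smooth_map (carrier G) A (carrier G) A (\<lambda>x. inv\<^bsub>G\<^esub> x)"

primrec lower_central :: "('g, 'm) monoid_scheme \<Rightarrow> nat \<Rightarrow> 'g set" where
  "lower_central G 0 = carrier G"
| "lower_central G (Suc k) = generate G
     {x \<otimes>\<^bsub>G\<^esub> y \<otimes>\<^bsub>G\<^esub> inv\<^bsub>G\<^esub> x \<otimes>\<^bsub>G\<^esub> inv\<^bsub>G\<^esub> y | x y. x \<in> carrier G \<and> y \<in> lower_central G k}"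

definition nilpotent_group :: "('g, 'm) monoid_scheme \<Rightarrow> bool" where
  "nilpotent_group G \<longleftrightarrow> (\<exists>k. lower_central G k = {\<one>\<^bsub>G\<^esub>})"

definition C_infinity :: "'p::topological_space set \<Rightarrow> ('p, 'e::real_normed_vector) atlas \<Rightarrow> ('p \<Rightarrow> real) set" where
  "C_infinity M A = {f \<in> extensional M. smooth_map M A UNIV std_atlas f}"

text \<open>The Lie algebra consists of the left-invariant vector fields, a vector field being a derivation
  of the algebra of smooth functions. Extensionality makes a field determined by its values on smooth
  functions.\<close>

definition vector_field ::
  "'p::topological_space set \<Rightarrow> ('p, 'e::real_normed_vector) atlas \<Rightarrow> (('p \<Rightarrow> real) \<Rightarrow> 'p \<Rightarrow> real) \<Rightarrow> bool" where
  "vector_field M A X \<longleftrightarrow> X \<in> C_infinity M A \<rightarrow>\<^sub>E C_infinity M A \<and>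
     (\<forall>f\<in>C_infinity M A. \<forall>g\<in>C_infinity M A. \<forall>p\<in>M.
        (\<forall>a b. X (\<lambda>q\<in>M. a * f q + b * g q) p = a * X f p + b * X g p) \<and>
        X (\<lambda>q\<in>M. f q * g q) p = X f p * g p + f p * X g p)"

definition lie_algebra ::
  "('g::topological_space, 'm) monoid_scheme \<Rightarrow> ('g, 'e::real_normed_vector) atlas \<Rightarrow> (('g \<Rightarrow> real) \<Rightarrow> 'g \<Rightarrow> real) set" where
  "lie_algebra G A = {X. vector_field (carrier G) A X \<and>
     (\<forall>a\<in>carrier G. \<forall>f\<in>C_infinity (carrier G) A. \<forall>p\<in>carrier G.
        X (\<lambda>q\<in>carrier G. f (a \<otimes>\<^bsub>G\<^esub> q)) p = X f (a \<otimes>\<^bsub>G\<^esub> p))}"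

text \<open>Calculus on the Lie algebra needs a normed vector space, so the Lie algebra, as a vector space,
  is identified with a type \<open>'v\<close> through a linear isomorphism \<open>\<iota>\<close>. The bracket is the commutator of
  derivations; it plays no role in what follows.\<close>

definition lie_algebra_iso ::
  "('g::topological_space, 'm) monoid_scheme \<Rightarrow> ('g, 'e::real_normed_vector) atlas \<Rightarrow>
   ('v::real_normed_vector \<Rightarrow> ('g \<Rightarrow> real) \<Rightarrow> 'g \<Rightarrow> real) \<Rightarrow> bool" where
  "lie_algebra_iso G A \<iota> \<longleftrightarrow> bij_betw \<iota> UNIV (lie_algebra G A) \<and>
     (\<forall>u v a b. \<forall>f\<in>C_infinity (carrier G) A. \<forall>p\<in>carrier G.
        \<iota> (a *\<^sub>R u + b *\<^sub>R v) f p = a * \<iota> u f p + b * \<iota> v f p)"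

definition one_parameter_subgroup ::
  "('g::topological_space, 'm) monoid_scheme \<Rightarrow> ('g, 'e::real_normed_vector) atlas \<Rightarrow>
   (('g \<Rightarrow> real) \<Rightarrow> 'g \<Rightarrow> real) \<Rightarrow> (real \<Rightarrow> 'g) \<Rightarrow> bool" where
  "one_parameter_subgroup G A X c \<longleftrightarrow>
     smooth_map UNIV std_atlas (carrier G) A c \<and> (\<forall>s t. c (s + t) = c s \<otimes>\<^bsub>G\<^esub> c t) \<and>
     (\<forall>f\<in>C_infinity (carrier G) A. ((\<lambda>t. f (c t)) has_real_derivative X f \<one>\<^bsub>G\<^esub>) (at 0))"

definition lie_exp ::
  "('g::topological_space, 'm) monoid_scheme \<Rightarrow> ('g, 'e::real_normed_vector) atlas \<Rightarrow>
   (('g \<Rightarrow> real) \<Rightarrow> 'g \<Rightarrow> real) \<Rightarrow> 'g" where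
  "lie_exp G A X = (THE c. one_parameter_subgroup G A X c) 1"

section \<open>Magnetic fields and their flux\<close>

text \<open>2-forms on a vector space are maps into the continuous bilinear forms; in finite dimension
  these are all the bilinear forms.\<close>

definition two_form :: "('v::real_normed_vector \<Rightarrow> 'v \<Rightarrow>\<^sub>L 'v \<Rightarrow>\<^sub>L real) \<Rightarrow> bool" where
  "two_form \<beta> \<longleftrightarrow> smooth_on UNIV \<beta> \<and>
     (\<forall>p u v. blinfun_apply (blinfun_apply (\<beta> p) u) v = - blinfun_apply (blinfun_apply (\<beta> p) v) u)"

text \<open>The exterior derivative evaluated on the constant vector fields \<open>u\<close>, \<open>v\<close>, \<open>w\<close>.\<close>

definition ext_deriv2 ::
  "('v::real_normed_vector \<Rightarrow> 'v \<Rightarrow>\<^sub>L 'v \<Rightarrow>\<^sub>L real) \<Rightarrow> 'v \<Rightarrow> 'v \<Rightarrow> 'v \<Rightarrow> 'v \<Rightarrow> real" where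
  "ext_deriv2 \<beta> p u v w =
     (let D = frechet_derivative \<beta> (at p) in
       blinfun_apply (blinfun_apply (D u) v) w
       - blinfun_apply (blinfun_apply (D v) u) w
       + blinfun_apply (blinfun_apply (D w) u) v)"

text \<open>In the following, \<open>E\<close> is the exponential map from the (identified) Lie algebra \<open>'v\<close> to the group,
  and a 2-form on the group is given in the global chart inverse to \<open>E\<close>.\<close>

definition magnetic_field ::
  "('v::real_normed_vector \<Rightarrow> 'g) \<Rightarrow> ('g \<Rightarrow> 'v \<Rightarrow>\<^sub>L 'v \<Rightarrow>\<^sub>L real) \<Rightarrow> bool" where
  "magnetic_field E B \<longleftrightarrow> two_form (B \<circ> E) \<and> (\<forall>p u v w. ext_deriv2 (B \<circ> E) p u v w = 0)"

definition triangle_point :: "('v::real_normed_vector \<Rightarrow> 'g) \<Rightarrow> 'g \<Rightarrow> 'g \<Rightarrow> 'g \<Rightarrow> real \<Rightarrow> real \<Rightarrow> 'g" where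
  "triangle_point E x y z t s =
     (let log = inv_into UNIV E in
       E (log x + t *\<^sub>R (log y - log x) + s *\<^sub>R (log z - log y)))"

definition flux ::
  "('v::real_normed_vector \<Rightarrow> 'g) \<Rightarrow> ('g \<Rightarrow> 'v \<Rightarrow>\<^sub>L 'v \<Rightarrow>\<^sub>L real) \<Rightarrow> 'g \<Rightarrow> 'g \<Rightarrow> 'g \<Rightarrow> real" where
  "flux E B x y z =
     (let log = inv_into UNIV E in
       integral {0..1} (\<lambda>t. integral {0..t} (\<lambda>s.
         blinfun_apply (blinfun_apply (B (triangle_point E x y z t s)) (log x - log y)) (log x - log z))))"

section \<open>The group of circle-valued continuous functions and 2-cocycles\<close>

definition circle_functions :: "('g::topological_space, 'm) monoid_scheme \<Rightarrow> ('g \<Rightarrow> complex) monoid" where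
  "circle_functions G =
     \<lparr>carrier = {c \<in> extensional (carrier G). continuous_on (carrier G) c \<and> c ` carrier G \<subseteq> sphere 0 1},
      mult = (\<lambda>c d. \<lambda>q\<in>carrier G. c q * d q),
      one = (\<lambda>q\<in>carrier G. 1)\<rparr>"

text \<open>The topology of uniform convergence on compact sets. The generating sets are neighbourhoods of
  their centre \<open>c\<close> by definition, and they are open since the maximum of \<open>dist (c q) (d q)\<close> over the
  compact set \<open>K\<close> is attained.\<close>

definition circle_functions_topology :: "('g::topological_space, 'm) monoid_scheme \<Rightarrow> ('g \<Rightarrow> complex) topology" where
  "circle_functions_topology G = topology_generated_by
     {{d \<in> carrier (circle_functions G). \<forall>q\<in>K. dist (c q) (d q) < e} | c K e.
        c \<in> carrier (circle_functions G) \<and> compact K \<and> K \<subseteq> carrier G \<and> e > 0}"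

definition left_translate :: "('g, 'm) monoid_scheme \<Rightarrow> 'g \<Rightarrow> ('g \<Rightarrow> complex) \<Rightarrow> 'g \<Rightarrow> complex" where
  "left_translate G x c = (\<lambda>q\<in>carrier G. c (inv\<^bsub>G\<^esub> x \<otimes>\<^bsub>G\<^esub> q))"

definition two_cocycle ::
  "('g::topological_space, 'm) monoid_scheme \<Rightarrow> ('g \<Rightarrow> 'g \<Rightarrow> 'g \<Rightarrow> complex) \<Rightarrow> bool" where
  "two_cocycle G \<gamma> \<longleftrightarrow>
     continuous_map (prod_topology (top_of_set (carrier G)) (top_of_set (carrier G)))
       (circle_functions_topology G) (\<lambda>(x, y). \<gamma> x y) \<and>
     (\<forall>x\<in>carrier G. \<forall>y\<in>carrier G. \<forall>z\<in>carrier G.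
        \<gamma> x y \<otimes>\<^bsub>circle_functions G\<^esub> \<gamma> (x \<otimes>\<^bsub>G\<^esub> y) z =
        left_translate G x (\<gamma> y z) \<otimes>\<^bsub>circle_functions G\<^esub> \<gamma> x (y \<otimes>\<^bsub>G\<^esub> z))"

definition magnetic_cocycle ::
  "('g, 'm) monoid_scheme \<Rightarrow> ('v::real_normed_vector \<Rightarrow> 'g) \<Rightarrow> ('g \<Rightarrow> 'v \<Rightarrow>\<^sub>L 'v \<Rightarrow>\<^sub>L real) \<Rightarrow>
   'g \<Rightarrow> 'g \<Rightarrow> 'g \<Rightarrow> complex" where
  "magnetic_cocycle G E B x y = (\<lambda>q\<in>carrier G.
     exp (\<i> * complex_of_real
       (flux E B q (inv\<^bsub>G\<^esub> x \<otimes>\<^bsub>G\<^esub> q) (inv\<^bsub>G\<^esub> y \<otimes>\<^bsub>G\<^esub> inv\<^bsub>G\<^esub> x \<otimes>\<^bsub>G\<^esub> q))))"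

end

theory Submission
  imports Defs
begin

text \<open>With \<open>x\<^sub>0 = q\<close>, \<open>x\<^sub>1 = x\<^sup>-\<^sup>1 q\<close>, \<open>x\<^sub>2 = y\<^sup>-\<^sup>1 x\<^sup>-\<^sup>1 q\<close>, \<open>x\<^sub>3 = z\<^sup>-\<^sup>1 y\<^sup>-\<^sup>1 x\<^sup>-\<^sup>1 q\<close>, the cocycle identity at
  \<open>q\<close> says that the fluxes of the closed form \<open>B\<close> through the four faces of the tetrahedron with these
  vertices add up to zero with suitable orientations. This is Stokes' theorem; it is obtained from the
  divergence theorem on the unit cube, which is collapsed onto the tetrahedron by the map
  \<open>(t, u, r) \<mapsto> a + t (b - a) + t u (c - b) + t u r (d - c)\<close>, where \<open>a, b, c, d\<close> are the vertices.
  Four faces of the cube go to the faces of the tetrahedron, and the remaining two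
  (\<open>t = 0\<close> and \<open>u = 0\<close>) become degenerate. Since the flux depends continuously on the vertices, \<open>\<gamma>\<close> is
  jointly continuous, which gives continuity into the compact-open topology. The normalisation holds
  because the triangles involved are degenerate.\<close>

section \<open>Integration over the unit cube\<close>

lemma continuous_on_compose_triple:
  assumes "continuous_on UNIV (\<lambda>(x, y, z). f x y z)"
    and "continuous_on S g" "continuous_on S h" "continuous_on S k"
  shows "continuous_on S (\<lambda>x. f (g x) (h x) (k x))"
  using continuous_on_compose2[OF assms(1) continuous_on_Pair[OF assms(2) continuous_on_Pair[OF assms(3,4)]]]
  by simp

lemma continuous_on_integral_unit_interval:
  fixes f :: "'x::topological_space \<Rightarrow> real \<Rightarrow> real"
  assumes "continuous_on (S \<times> UNIV) (\<lambda>(x, t). f x t)"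
  shows "continuous_on S (\<lambda>x. integral {0..1} (f x))"
  using integral_continuous_on_param[of S 0 1 f] assms by (auto intro: continuous_on_subset)

text \<open>Fubini moves the integral over the variable of differentiation to the inside, where the
  fundamental theorem of calculus evaluates it. Joint continuity is asked only of the three partial
  derivatives that make up the divergence.\<close>

lemma divergence_theorem_unit_cube:
  fixes P Q R P' Q' R' :: "real \<Rightarrow> real \<Rightarrow> real \<Rightarrow> real"
  assumes cont: "continuous_on UNIV (\<lambda>(t, u, r). P' t u r)"
    "continuous_on UNIV (\<lambda>(t, u, r). Q' t u r)" "continuous_on UNIV (\<lambda>(t, u, r). R' t u r)"
    and P: "\<And>t u r. ((\<lambda>t. P t u r) has_real_derivative P' t u r) (at t)"
    and Q: "\<And>t u r. ((\<lambda>u. Q t u r) has_real_derivative Q' t u r) (at u)"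
    and R: "\<And>t u r. ((\<lambda>r. R t u r) has_real_derivative R' t u r) (at r)"
  shows "integral {0..1} (\<lambda>u. integral {0..1} (\<lambda>r. P 1 u r - P 0 u r)) +
    integral {0..1} (\<lambda>t. integral {0..1} (\<lambda>r. Q t 1 r - Q t 0 r)) +
    integral {0..1} (\<lambda>t. integral {0..1} (\<lambda>u. R t u 1 - R t u 0)) =
    integral {0..1} (\<lambda>t. integral {0..1} (\<lambda>u. integral {0..1} (\<lambda>r. P' t u r + Q' t u r + R' t u r)))"
proof -
  note c = cont[THEN continuous_on_compose_triple]
  have swap: "integral {0..1} (\<lambda>x. integral {0..1} (\<lambda>y. f x y)) =
      integral {0..1} (\<lambda>y. integral {0..1} (\<lambda>x. f x y))"
    if "continuous_on UNIV (\<lambda>(x, y). f x y)" for f :: "real \<Rightarrow> real \<Rightarrow> real"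
    using integral_swap_continuous[of 0 0 1 1 f] that by (auto intro: continuous_on_subset)
  have ftc: "integral {0..1} f' = f 1 - f 0"
    if "\<And>x. (f has_real_derivative f' x) (at x)" for f f' :: "real \<Rightarrow> real"
    using that by (intro integral_unique fundamental_theorem_of_calculus)
      (auto simp: has_real_derivative_iff_has_vector_derivative[symmetric] intro: DERIV_subset)
  have int: "f integrable_on {0..1}" if "continuous_on UNIV f" for f :: "real \<Rightarrow> real"
    using that by (intro integrable_continuous_real) (auto intro: continuous_on_subset)
  let ?I = "\<lambda>f. integral {0..1::real} (\<lambda>t. integral {0..1::real} (\<lambda>u.
    integral {0..1::real} (\<lambda>r. f t u r :: real)))"
  have add: "?I (\<lambda>t u r. f t u r + g t u r) = ?I f + ?I g"
    if fg: "continuous_on UNIV (\<lambda>(t, u, r). f t u r)" "continuous_on UNIV (\<lambda>(t, u, r). g t u r)" for f g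
  proof -
    note c' = fg[THEN continuous_on_compose_triple]
    \<comment> \<open>The loop works from the outside in: split the integral of a sum, then get
      integrability of each summand from continuity in the variables still free.\<close>
    show ?thesis
      by (subst integral_add[symmetric] int | intro int continuous_on_integral_unit_interval |
          simp add: case_prod_beta | intro c' continuous_intros)+
  qed
  \<comment> \<open>Two exchanges carry the integral over \<open>t\<close> inwards, first past
    \<open>u\<close>, then past \<open>r\<close>. For \<open>Q'\<close> one exchange is enough, for
    \<open>R'\<close> none is needed.\<close>
  have "?I P' = integral {0..1} (\<lambda>u. integral {0..1} (\<lambda>t. integral {0..1} (\<lambda>r. P' t u r)))"
    by (rule swap) (simp add: case_prod_beta, intro continuous_on_integral_unit_interval,
      simp add: case_prod_beta, intro c continuous_intros)
  also have "\<dots> = integral {0..1} (\<lambda>u. integral {0..1} (\<lambda>r. P 1 u r - P 0 u r))"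
  proof (rule integral_cong)
    show "integral {0..1} (\<lambda>t. integral {0..1} (\<lambda>r. P' t u r)) =
        integral {0..1} (\<lambda>r. P 1 u r - P 0 u r)" for u
      using swap[of "\<lambda>t r. P' t u r"] by (simp add: case_prod_beta ftc[OF P] c continuous_intros)
  qed
  finally have 1: "?I P' = integral {0..1} (\<lambda>u. integral {0..1} (\<lambda>r. P 1 u r - P 0 u r))" .
  have 2: "integral {0..1} (\<lambda>u. integral {0..1} (\<lambda>r. Q' t u r)) =
      integral {0..1} (\<lambda>r. Q t 1 r - Q t 0 r)" for t
    using swap[of "\<lambda>u r. Q' t u r"] by (simp add: case_prod_beta ftc[OF Q] c continuous_intros)
  have 3: "?I R' = integral {0..1} (\<lambda>t. integral {0..1} (\<lambda>u. R t u 1 - R t u 0))"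
    by (simp add: ftc[OF R])
  have "?I (\<lambda>t u r. P' t u r + Q' t u r + R' t u r) = ?I P' + ?I Q' + ?I R'"
    by (subst add add, (simp add: case_prod_beta, intro c continuous_intros)+)
      (simp add: add cont)
  then show ?thesis
    by (simp add: 1 2 3)
qed

section \<open>Stokes' theorem on a tetrahedron\<close>

lemma has_real_derivative_bilinear_form_along:
  fixes \<beta> :: "'v::real_normed_vector \<Rightarrow> 'v \<Rightarrow>\<^sub>L 'v \<Rightarrow>\<^sub>L real"
  assumes "\<beta> differentiable (at (g t))"
    and "(g has_vector_derivative g') (at t)" "(h has_vector_derivative h') (at t)"
    and "(k has_vector_derivative k') (at t)"
  shows "((\<lambda>t. \<beta> (g t) (h t) (k t)) has_real_derivative
     frechet_derivative \<beta> (at (g t)) g' (h t) (k t) + \<beta> (g t) h' (k t) + \<beta> (g t) (h t) k') (at t)"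
proof -
  let ?D = "frechet_derivative \<beta> (at (g t))"
  \<comment> \<open>Chain rule along the curve \<open>g\<close>, then the product rule for
    evaluation of bounded linear maps, once for each argument of the form.\<close>
  have D: "(\<beta> has_derivative ?D) (at (g t))"
    using assms(1) by (simp add: frechet_derivative_works)
  then have "((\<lambda>t. \<beta> (g t)) has_vector_derivative ?D g') (at t)"
    using vector_derivative_diff_chain_within[of g g' t UNIV \<beta> ?D] assms(2)
    by (auto intro: has_derivative_at_withinI simp: o_def)
  then have "((\<lambda>t. \<beta> (g t) (h t)) has_vector_derivative \<beta> (g t) h' + ?D g' (h t)) (at t)"
    by (rule bounded_bilinear.has_vector_derivative[OF bounded_bilinear_blinfun_apply]) (rule assms(3))
  from bounded_bilinear.has_vector_derivative[OF bounded_bilinear_blinfun_apply this assms(4)]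
  show ?thesis
    by (simp add: has_real_derivative_iff_has_vector_derivative blinfun.add_left algebra_simps)
qed

text \<open>The unit square is mapped onto the triangle \<open>a\<close>, \<open>b\<close>, \<open>c\<close>. In terms of the parameters of
  \<^const>\<open>flux\<close> this is the substitution \<open>s = t * u\<close>, whence the factor \<open>t\<close>.\<close>

definition triangle_flux :: "('v::real_normed_vector \<Rightarrow> 'v \<Rightarrow>\<^sub>L 'v \<Rightarrow>\<^sub>L real) \<Rightarrow> 'v \<Rightarrow> 'v \<Rightarrow> 'v \<Rightarrow> real" where
  "triangle_flux \<beta> a b c = integral {0..1} (\<lambda>t. integral {0..1} (\<lambda>u.
     t * \<beta> (a + t *\<^sub>R (b - a) + (t * u) *\<^sub>R (c - b)) (b - a) (c - b)))"

lemma two_form_self: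
  assumes "two_form \<beta>" shows "\<beta> p u u = 0"
  using assms unfolding two_form_def by (metis neg_equal_zero)

lemma tetrahedron_flux:
  fixes \<beta> :: "'v::real_normed_vector \<Rightarrow> 'v \<Rightarrow>\<^sub>L 'v \<Rightarrow>\<^sub>L real"
  assumes \<beta>: "two_form \<beta>" and closed: "\<And>p u v w. ext_deriv2 \<beta> p u v w = 0"
  shows "triangle_flux \<beta> a b c + triangle_flux \<beta> a c d = triangle_flux \<beta> b c d + triangle_flux \<beta> a b d"
proof -
  define v1 v2 v3 where "v1 = b - a" and "v2 = c - b" and "v3 = d - c"
  have ca: "c - a = v1 + v2" and db: "d - b = v2 + v3"
    by (simp_all add: v1_def v2_def v3_def)
  \<comment> \<open>The collapsing map of the cube and its three partial derivatives.
    \<open>\<Phi>u\<close> vanishes at \<open>t = 0\<close>, and \<open>\<Phi>r\<close> at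
    \<open>t = 0\<close> and at \<open>u = 0\<close>, which makes these two faces of the cube
    degenerate.\<close>
  define \<Phi> where "\<Phi> = (\<lambda>t u r::real. a + t *\<^sub>R v1 + (t * u) *\<^sub>R v2 + (t * u * r) *\<^sub>R v3)"
  define \<Phi>t where "\<Phi>t = (\<lambda>u r::real. v1 + u *\<^sub>R v2 + (u * r) *\<^sub>R v3)"
  define \<Phi>u where "\<Phi>u = (\<lambda>t r::real. t *\<^sub>R v2 + (t * r) *\<^sub>R v3)"
  define \<Phi>r where "\<Phi>r = (\<lambda>t u::real. (t * u) *\<^sub>R v3)"
  define D where "D = (\<lambda>p. frechet_derivative \<beta> (at p))"
  have diff: "\<beta> differentiable (at p)" and contD: "continuous_on UNIV (\<lambda>p. D p v)" for p v
    using \<beta> unfolding two_form_def smooth_on_def D_def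
    by (auto dest!: spec[of _ "Suc 0"])
  have cont\<beta>: "continuous_on UNIV \<beta>"
    using \<beta> unfolding two_form_def smooth_on_def by (auto dest!: spec[of _ 0])
  have linD: "linear (D p)" for p
    using diff[of p] unfolding D_def by (rule linear_frechet_derivative)
  have c\<beta>: "continuous_on S (\<lambda>x. \<beta> (f x))" and cD: "continuous_on S (\<lambda>x. D (f x) v)"
    if "continuous_on S f" for S and f :: "real \<times> real \<times> real \<Rightarrow> 'v" and v
    using continuous_on_compose2[OF cont\<beta> that] continuous_on_compose2[OF contD that] by auto
  have der: "((\<lambda>t. \<beta> (g t) (h t) (k t)) has_real_derivative
      D (g t) g' (h t) (k t) + \<beta> (g t) h' (k t) + \<beta> (g t) (h t) k') (at t)"
    if "(g has_vector_derivative g') (at t)" "(h has_vector_derivative h') (at t)"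
      "(k has_vector_derivative k') (at t)" for g h k g' h' k' t
    unfolding D_def by (rule has_real_derivative_bilinear_form_along[OF diff that])
  note self = two_form_self[OF \<beta>]
  note skew = \<beta>[unfolded two_form_def, THEN conjunct2, rule_format]
  \<comment> \<open>The coefficients of the pullback of \<open>\<beta>\<close> under
    \<open>\<Phi>\<close>, which is \<open>P du dr - Q dt dr + R dt du\<close> with wedge products
    understood. The divergence of \<open>(P, Q, R)\<close> is therefore the coefficient of the
    exterior derivative of the pullback.\<close>
  define P where "P = (\<lambda>t u r. \<beta> (\<Phi> t u r) (\<Phi>u t r) (\<Phi>r t u))"
  define Q where "Q = (\<lambda>t u r. - \<beta> (\<Phi> t u r) (\<Phi>t u r) (\<Phi>r t u))"
  define R where "R = (\<lambda>t u r. \<beta> (\<Phi> t u r) (\<Phi>t u r) (\<Phi>u t r))"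
  define P' where "P' = (\<lambda>t u r. D (\<Phi> t u r) (\<Phi>t u r) (\<Phi>u t r) (\<Phi>r t u) +
    \<beta> (\<Phi> t u r) (v2 + r *\<^sub>R v3) (\<Phi>r t u) + \<beta> (\<Phi> t u r) (\<Phi>u t r) (u *\<^sub>R v3))"
  define Q' where "Q' = (\<lambda>t u r. - (D (\<Phi> t u r) (\<Phi>u t r) (\<Phi>t u r) (\<Phi>r t u) +
    \<beta> (\<Phi> t u r) (v2 + r *\<^sub>R v3) (\<Phi>r t u) + \<beta> (\<Phi> t u r) (\<Phi>t u r) (t *\<^sub>R v3)))"
  define R' where "R' = (\<lambda>t u r. D (\<Phi> t u r) (\<Phi>r t u) (\<Phi>t u r) (\<Phi>u t r) +
    \<beta> (\<Phi> t u r) (u *\<^sub>R v3) (\<Phi>u t r) + \<beta> (\<Phi> t u r) (\<Phi>t u r) (t *\<^sub>R v3))"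
  note \<Phi>_defs = \<Phi>_def \<Phi>t_def \<Phi>u_def \<Phi>r_def
  have c\<Phi>: "continuous_on UNIV (\<lambda>z. \<Phi> (fst z) (fst (snd z)) (snd (snd z)))"
    unfolding \<Phi>_def by (intro continuous_intros)
  have "((\<lambda>t. P t u r) has_real_derivative P' t u r) (at t)" for t u r
    unfolding P_def P'_def
    by (rule der[
        where g="\<lambda>t. \<Phi> t u r" and t=t and h="\<lambda>t. \<Phi>u t r" and k="\<lambda>t. \<Phi>r t u"]; unfold \<Phi>_defs)
      (auto intro!: derivative_eq_intros simp: algebra_simps)
  moreover have "((\<lambda>u. Q t u r) has_real_derivative Q' t u r) (at u)" for t u r
    unfolding Q_def Q'_def
    by (rule DERIV_minus, rule der[
        where g="\<lambda>u. \<Phi> t u r" and t=u and h="\<lambda>u. \<Phi>t u r" and k="\<lambda>u. \<Phi>r t u"]; unfold \<Phi>_defs)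
      (auto intro!: derivative_eq_intros simp: algebra_simps)
  moreover have "((\<lambda>r. R t u r) has_real_derivative R' t u r) (at r)" for t u r
    unfolding R_def R'_def
    by (rule der[
        where g="\<lambda>r. \<Phi> t u r" and t=r and h="\<lambda>r. \<Phi>t u r" and k="\<lambda>r. \<Phi>u t r"]; unfold \<Phi>_defs)
      (auto intro!: derivative_eq_intros simp: algebra_simps)
  \<comment> \<open>\<open>contD\<close> gives continuity of \<open>D\<close> only for a fixed
    direction, so the moving direction is first expanded by linearity into multiples of
    \<open>v1\<close>, \<open>v2\<close>, \<open>v3\<close>.\<close>
  moreover have
    "continuous_on UNIV (\<lambda>(t, u, r). P' t u r)"
    "continuous_on UNIV (\<lambda>(t, u, r). Q' t u r)"
    "continuous_on UNIV (\<lambda>(t, u, r). R' t u r)"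
    unfolding P'_def Q'_def R'_def \<Phi>t_def \<Phi>u_def \<Phi>r_def case_prod_beta
      linear_add[OF linD] linear_scale[OF linD]
    by (intro continuous_intros c\<beta> cD c\<Phi>)+
  \<comment> \<open>The three terms with \<open>D\<close> add up to the exterior derivative of
    \<open>\<beta>\<close> on the tangent vectors. The terms with mixed second derivatives of
    \<open>\<Phi>\<close> cancel in pairs: two pairs by their signs, the third by skew
    symmetry.\<close>
  moreover have "P' t u r + Q' t u r + R' t u r = 0" for t u r
    using closed[of "\<Phi> t u r" "\<Phi>t u r" "\<Phi>u t r" "\<Phi>r t u"] skew[of "\<Phi> t u r" "\<Phi>u t r" "u *\<^sub>R v3"]
    unfolding P'_def Q'_def R'_def ext_deriv2_def Let_def D_def by simp
  ultimately have
   "integral {0..1} (\<lambda>u. integral {0..1} (\<lambda>r. P 1 u r - P 0 u r)) +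
    integral {0..1} (\<lambda>t. integral {0..1} (\<lambda>r. Q t 1 r - Q t 0 r)) +
    integral {0..1} (\<lambda>t. integral {0..1} (\<lambda>u. R t u 1 - R t u 0)) = 0"
    using divergence_theorem_unit_cube[of P' Q' R' P Q R] by simp
  \<comment> \<open>At \<open>t = 1\<close> the parameters \<open>u\<close>, \<open>r\<close> play
    the roles of \<open>t\<close>, \<open>u\<close> in \<open>triangle_flux\<close>; the form is
    alternating, so only the \<open>v2\<close>, \<open>v3\<close> term remains.\<close>
  moreover have "integral {0..1} (\<lambda>u. integral {0..1} (\<lambda>r. P 1 u r - P 0 u r)) = triangle_flux \<beta> b c d"
    unfolding triangle_flux_def P_def \<Phi>_defs v1_def v2_def v3_def
    by (simp add: blinfun.add_right blinfun.add_left blinfun.scaleR_right blinfun.scaleR_left self)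
  \<comment> \<open>At \<open>u = 1\<close> the vectors \<open>v1\<close> and \<open>v2\<close> add
    up to the edge \<open>c - a\<close>; the minus sign comes from the definition of
    \<open>Q\<close>.\<close>
  moreover have "integral {0..1} (\<lambda>t. integral {0..1} (\<lambda>r. Q t 1 r - Q t 0 r)) = - triangle_flux \<beta> a c d"
    unfolding triangle_flux_def Q_def \<Phi>_defs ca v3_def[symmetric]
    by (simp add: blinfun.add_right blinfun.add_left blinfun.scaleR_right blinfun.scaleR_left self
      scaleR_add_right add.assoc)
  moreover have "integral {0..1} (\<lambda>t. integral {0..1} (\<lambda>u. R t u 1 - R t u 0)) =
      triangle_flux \<beta> a b d - triangle_flux \<beta> a b c"
  proof -
    have "\<Phi>t u r = v1 + u *\<^sub>R (v2 + r *\<^sub>R v3)" "\<Phi>u t r = t *\<^sub>R (v2 + r *\<^sub>R v3)" for t u r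
      unfolding \<Phi>_defs by (simp_all add: algebra_simps)
    \<comment> \<open>The part of \<open>\<Phi>t\<close> along \<open>v2 + r *\<^sub>R v3\<close> is
      parallel to \<open>\<Phi>u\<close> and drops out. What is left is the integrand of the
      triangle \<open>a, b, d\<close> at \<open>r = 1\<close> and of \<open>a, b, c\<close> at
      \<open>r = 0\<close>.\<close>
    then have R: "R t u r = t * \<beta> (\<Phi> t u r) v1 (v2 + r *\<^sub>R v3)" for t u r
      unfolding R_def
      by (simp add: blinfun.add_right[of _ v1] blinfun.add_left blinfun.scaleR_right blinfun.scaleR_left self)
    have cR: "continuous_on S (\<lambda>x. R (f x) (g x) r)"
      if "continuous_on S f" "continuous_on S g" for S and f g :: "real \<times> real \<Rightarrow> real" and r
      unfolding R \<Phi>_def by (intro continuous_intros continuous_on_compose2[OF cont\<beta>] that) auto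
    have cR1: "continuous_on S (\<lambda>u. R t u r)" for S t r
      unfolding R \<Phi>_def by (intro continuous_intros continuous_on_compose2[OF cont\<beta>]) auto
    have "triangle_flux \<beta> a b d = integral {0..1} (\<lambda>t. integral {0..1} (\<lambda>u. R t u 1))"
      unfolding triangle_flux_def R \<Phi>_def db v1_def[symmetric] by (simp add: algebra_simps)
    moreover have "triangle_flux \<beta> a b c = integral {0..1} (\<lambda>t. integral {0..1} (\<lambda>u. R t u 0))"
      unfolding triangle_flux_def R \<Phi>_def v1_def[symmetric] v2_def[symmetric] by simp
    moreover have "(\<lambda>u. R t u r) integrable_on {0..1}" for t r
      by (intro integrable_continuous_real cR1)
    moreover have "(\<lambda>t. integral {0..1} (\<lambda>u. R t u r)) integrable_on {0..1}" for r
      by (intro integrable_continuous_real continuous_on_integral_unit_interval)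
        (simp add: case_prod_beta cR continuous_intros)
    ultimately show ?thesis
      by (simp add: integral_diff)
  qed
  ultimately show ?thesis by simp
qed

section \<open>Continuity of the flux and of maps into the compact-open topology\<close>

lemma continuous_on_triangle_flux:
  fixes \<beta> :: "'v::real_normed_vector \<Rightarrow> 'v \<Rightarrow>\<^sub>L 'v \<Rightarrow>\<^sub>L real"
  assumes \<beta>: "continuous_on UNIV \<beta>"
    and abc: "continuous_on S a" "continuous_on S b" "continuous_on S c"
  shows "continuous_on S (\<lambda>x. triangle_flux \<beta> (a x) (b x) (c x))"
proof -
  \<comment> \<open>The two integrals are peeled off one after the other, so the innermost integrand
    lives on triples \<open>((x, t), u)\<close>, with the vertices depending on \<open>x\<close>
    alone.\<close>
  have fst_fst: "continuous_on ((S \<times> UNIV) \<times> UNIV) (\<lambda>z. g (fst (fst z)))"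
    if "continuous_on S g" for g :: "_ \<Rightarrow> 'v"
    by (rule continuous_on_compose2[OF that]) (auto intro!: continuous_intros)
  show ?thesis
    unfolding triangle_flux_def
    by (intro continuous_on_integral_unit_interval, unfold case_prod_beta,
        intro continuous_on_integral_unit_interval, unfold case_prod_beta,
        intro continuous_intros continuous_on_compose2[OF \<beta>] fst_fst abc) auto
qed

text \<open>One direction of the exponential law. For compact \<open>K\<close> the projection of
  \<open>S \<times> K\<close> to \<open>S\<close> is a closed map, so the parameters at which a
  uniform bound on \<open>K\<close> fails form a closed set.\<close>

lemma continuous_map_circle_functions_topology:
  fixes f :: "'p::topological_space \<Rightarrow> 'g::topological_space \<Rightarrow> complex"
  assumes f: "continuous_on (S \<times> carrier G) (\<lambda>(p, q). f p q)"
    and range: "\<And>p q. p \<in> S \<Longrightarrow> q \<in> carrier G \<Longrightarrow> norm (f p q) = 1"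
  shows "continuous_map (top_of_set S) (circle_functions_topology G) (\<lambda>p. \<lambda>q\<in>carrier G. f p q)"
proof -
  have in_carrier: "(\<lambda>q\<in>carrier G. f p q) \<in> carrier (circle_functions G)" if "p \<in> S" for p
  proof -
    have "continuous_on (carrier G) (\<lambda>q. f p q)"
      using continuous_on_compose2[OF f continuous_on_Pair[OF continuous_on_const continuous_on_id]] that
      by auto
    then show ?thesis
      using range[OF that] by (auto simp: circle_functions_def)
  qed
  have "openin (top_of_set S) {p \<in> S. \<forall>q\<in>K. dist (c q) (f p q) < e}"
    if c: "c \<in> carrier (circle_functions G)" and K: "compact K" "K \<subseteq> carrier G"
    for c K and e :: real
  proof -
    \<comment> \<open>The pairs at which the bound fails; the projection of \<open>?F\<close> is the
      complement of the set to be shown open.\<close>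
    let ?F = "(S \<times> K) \<inter> (\<lambda>z. dist (c (snd z)) (f (fst z) (snd z))) -` {e..}"
    have "continuous_on (S \<times> K) (\<lambda>z. c (snd z))"
      using continuous_on_compose2[OF _ continuous_on_snd[OF continuous_on_id], of "carrier G" c "S \<times> K"] c K
      by (auto simp: circle_functions_def split: if_splits)
    moreover have "continuous_on (S \<times> K) (\<lambda>z. f (fst z) (snd z))"
      using f K by (auto simp: case_prod_beta intro: continuous_on_subset)
    ultimately have "closedin (top_of_set (S \<times> K)) ?F"
      by (intro continuous_closedin_preimage continuous_on_dist) auto
    moreover have "closed_map (prod_topology (top_of_set S) (top_of_set K)) (top_of_set S) fst"
      using K by (intro Abstract_Topological_Spaces.closed_map_fst) (simp add: compact_space_subtopology)
    ultimately have "closedin (top_of_set S) (fst ` ?F)"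
      by (simp add: closed_map_def subtopology_Times euclidean_product_topology)
    moreover have "fst ` ?F = {p \<in> S. \<exists>q\<in>K. e \<le> dist (c q) (f p q)}"
      by (auto simp: image_def Bex_def)
    then have "{p \<in> S. \<forall>q\<in>K. dist (c q) (f p q) < e} = topspace (top_of_set S) - fst ` ?F"
      by (auto simp: not_less)
    ultimately show ?thesis
      by (simp only: openin_diff openin_topspace)
  qed
  then show ?thesis
    unfolding circle_functions_topology_def
  proof (intro continuous_on_generated_topo, goal_cases)
    case (1 U)
    then obtain c K and e :: real where cKe: "c \<in> carrier (circle_functions G)" "compact K" "K \<subseteq> carrier G"
      and U: "U = {d \<in> carrier (circle_functions G). \<forall>q\<in>K. dist (c q) (d q) < e}"
      by blast
    have "(\<lambda>p. \<lambda>q\<in>carrier G. f p q) -` U \<inter> topspace (top_of_set S) =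
        {p \<in> S. \<forall>q\<in>K. dist (c q) (f p q) < e}"
      using in_carrier cKe(3) unfolding U by auto
    then show ?case
      using 1(1)[OF cKe, of e] by simp
  next
    \<comment> \<open>The generating sets have to cover the image. For \<open>K = {}\<close> the
      bound is vacuous, and the generating set is the whole group of circle-valued
      functions.\<close>
    case 2
    show ?case
    proof (rule image_subsetI)
      fix p assume "p \<in> topspace (top_of_set S)"
      then have "(\<lambda>q\<in>carrier G. f p q) \<in> carrier (circle_functions G)" (is "?d \<in> _")
        using in_carrier by simp
      then show "?d \<in> \<Union> {{d \<in> carrier (circle_functions G). \<forall>q\<in>K. dist (c q) (d q) < e} | c K e.
          c \<in> carrier (circle_functions G) \<and> compact K \<and> K \<subseteq> carrier G \<and> e > 0}"
        by (intro UnionI[of "{d \<in> carrier (circle_functions G). \<forall>q\<in>{}. dist (?d q) (d q) < 1}"]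
            CollectI exI[of _ ?d] exI[of _ "{}"] exI[of _ 1] conjI) simp_all
    qed
  qed
qed

section \<open>The flux in the logarithmic chart and the cocycle\<close>

lemma flux_eq_triangle_flux:
  fixes B :: "'g \<Rightarrow> 'v::real_normed_vector \<Rightarrow>\<^sub>L 'v \<Rightarrow>\<^sub>L real"
  assumes "inj E" "two_form (B \<circ> E)"
  shows "flux E B (E a) (E b) (E c) = triangle_flux (B \<circ> E) a b c"
proof -
  let ?g = "\<lambda>t s. (B \<circ> E) (a + t *\<^sub>R (b - a) + s *\<^sub>R (c - b)) (b - a) (c - b)"
  have cont: "continuous_on UNIV (B \<circ> E)"
    using assms(2) unfolding two_form_def smooth_on_def by (auto dest!: spec[of _ 0])
  \<comment> \<open>Since \<open>a - c\<close> is the sum of \<open>a - b\<close> and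
    \<open>b - c\<close>, the first summand contributes nothing to the alternating form, and the two
    remaining signs cancel.\<close>
  have form: "(B \<circ> E) p (a - b) (a - c) = (B \<circ> E) p (b - a) (c - b)" for p
    using two_form_self[OF assms(2)] assms(2)[unfolded two_form_def, THEN conjunct2, rule_format, of p a b]
    by (simp add: blinfun.diff_left blinfun.diff_right)
  have "flux E B (E a) (E b) (E c) = integral {0..1} (\<lambda>t. integral {0..t} (?g t))"
    unfolding flux_def triangle_point_def Let_def inv_f_f[OF assms(1)] form[unfolded o_def] by simp
  also have "\<dots> = integral {0..1} (\<lambda>t. integral {0..1} (\<lambda>u. t * ?g t (t * u)))"
  proof (rule integral_cong)
    fix t :: real assume "t \<in> {0..1}"
    moreover have "continuous_on {0..1} (?g t)"
      by (intro continuous_intros continuous_on_compose2[OF cont]) auto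
    \<comment> \<open>The substitution \<open>u \<mapsto> t * u\<close> need not be strictly
      increasing, so \<open>t = 0\<close> is not a separate case.\<close>
    ultimately have "((\<lambda>u. t *\<^sub>R ?g t (t * u)) has_integral integral {t * 0..t * 1} (?g t)) {0..1}"
      by (intro has_integral_substitution[where c=0 and d=1])
        (auto intro!: derivative_eq_intros mult_le_one)
    from integral_unique[OF this]
    show "integral {0..t} (?g t) = integral {0..1} (\<lambda>u. t * ?g t (t * u))"
      by simp
  qed
  finally show ?thesis
    unfolding triangle_flux_def .
qed

theorem proposition4p3:
  fixes G :: "('g::topological_space, 'm) monoid_scheme"
    and A :: "('g, 'e::real_normed_vector) atlas"
    and \<iota> :: "'v::real_normed_vector \<Rightarrow> ('g \<Rightarrow> real) \<Rightarrow> 'g \<Rightarrow> real"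
    and E :: "'v \<Rightarrow> 'g"
    and B :: "'g \<Rightarrow> 'v \<Rightarrow>\<^sub>L 'v \<Rightarrow>\<^sub>L real"
  defines "E \<equiv> \<lambda>v. lie_exp G A (\<iota> v)"
  assumes "lie_group G A"
    and "connected (carrier G)" and "simply_connected (carrier G)"
    and "nilpotent_group G"
    and "lie_algebra_iso G A \<iota>"
    and "diffeomorphism UNIV std_atlas (carrier G) A E"
    and "magnetic_field E B"
  shows "two_cocycle G (magnetic_cocycle G E B) \<and>
    (\<forall>x\<in>carrier G.
      magnetic_cocycle G E B (inv\<^bsub>G\<^esub> x) x = \<one>\<^bsub>circle_functions G\<^esub> \<and>
      magnetic_cocycle G E B x (inv\<^bsub>G\<^esub> x) = \<one>\<^bsub>circle_functions G\<^esub>)"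
proof -
  have "group G" and mult: "continuous_on (carrier G \<times> carrier G) (\<lambda>(x, y). x \<otimes>\<^bsub>G\<^esub> y)"
    and inverse: "continuous_on (carrier G) (\<lambda>x. inv\<^bsub>G\<^esub> x)"
    using assms(2) by (simp_all add: lie_group_def smooth_map_def)
  interpret group G by fact
  let ?log = "inv_into UNIV E"
  let ?F = "triangle_flux (B \<circ> E)"
  have "inj E" and surj: "range E = carrier G" and log: "continuous_on (carrier G) ?log"
    using assms(7) by (auto simp: diffeomorphism_def bij_betw_def smooth_map_def)
  have B: "two_form (B \<circ> E)" and closed: "\<And>p u v w. ext_deriv2 (B \<circ> E) p u v w = 0"
    using assms(8) by (auto simp: magnetic_field_def)
  have cont: "continuous_on UNIV (B \<circ> E)"
    using B unfolding two_form_def smooth_on_def by (auto dest!: spec[of _ 0])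
  have flux: "flux E B x y z = ?F (?log x) (?log y) (?log z)"
    if "x \<in> carrier G" "y \<in> carrier G" "z \<in> carrier G" for x y z
    using flux_eq_triangle_flux[OF \<open>inj E\<close> B, of "?log x" "?log y" "?log z"] that
    by (simp add: f_inv_into_f surj)
  let ?\<gamma> = "\<lambda>(x, y) q. exp (\<i> * complex_of_real
    (flux E B q (inv\<^bsub>G\<^esub> x \<otimes>\<^bsub>G\<^esub> q) (inv\<^bsub>G\<^esub> y \<otimes>\<^bsub>G\<^esub> inv\<^bsub>G\<^esub> x \<otimes>\<^bsub>G\<^esub> q)))"
  let ?S = "carrier G \<times> carrier G"
  have mult': "continuous_on T (\<lambda>z. f z \<otimes>\<^bsub>G\<^esub> g z)"
    if "continuous_on T f" "continuous_on T g" "f ` T \<subseteq> carrier G" "g ` T \<subseteq> carrier G"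
    for T :: "(('g \<times> 'g) \<times> 'g) set" and f g
    using continuous_on_compose2[OF mult continuous_on_Pair[OF that(1,2)]] that(3,4) by auto
  \<comment> \<open>Continuity is shown in logarithmic coordinates and then carried over to
    \<open>flux\<close>, which agrees with \<open>?F\<close> for points of the carrier.\<close>
  have "continuous_on (?S \<times> carrier G) (\<lambda>z. exp (\<i> * complex_of_real
    (?F (?log (snd z)) (?log (inv\<^bsub>G\<^esub> (fst (fst z)) \<otimes>\<^bsub>G\<^esub> snd z))
      (?log (inv\<^bsub>G\<^esub> (snd (fst z)) \<otimes>\<^bsub>G\<^esub> inv\<^bsub>G\<^esub> (fst (fst z)) \<otimes>\<^bsub>G\<^esub> snd z)))))"
    by (intro continuous_intros continuous_on_triangle_flux cont continuous_on_compose2[OF log]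
        mult' continuous_on_compose2[OF inverse]) auto
  then have "continuous_on (?S \<times> carrier G) (\<lambda>(p, q). ?\<gamma> p q)"
    by (rule continuous_on_eq) (auto simp: flux)
  then have "continuous_map (top_of_set ?S) (circle_functions_topology G) (\<lambda>p. \<lambda>q\<in>carrier G. ?\<gamma> p q)"
    by (rule continuous_map_circle_functions_topology) auto
  moreover have "(\<lambda>p. \<lambda>q\<in>carrier G. ?\<gamma> p q) = (\<lambda>(x, y). magnetic_cocycle G E B x y)"
    by (auto simp: magnetic_cocycle_def fun_eq_iff)
  ultimately have continuous: "continuous_map
      (prod_topology (top_of_set (carrier G)) (top_of_set (carrier G)))
      (circle_functions_topology G) (\<lambda>(x, y). magnetic_cocycle G E B x y)"
    by (simp add: subtopology_Times euclidean_product_topology)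
  have "magnetic_cocycle G E B x y \<otimes>\<^bsub>circle_functions G\<^esub> magnetic_cocycle G E B (x \<otimes>\<^bsub>G\<^esub> y) z =
      left_translate G x (magnetic_cocycle G E B y z) \<otimes>\<^bsub>circle_functions G\<^esub>
        magnetic_cocycle G E B x (y \<otimes>\<^bsub>G\<^esub> z)"
    if "x \<in> carrier G" "y \<in> carrier G" "z \<in> carrier G" for x y z
  proof -
    \<comment> \<open>With vertices \<open>a, b, c, d\<close> in the order of the instantiation
      below, the terms are the faces \<open>abc\<close>, \<open>acd\<close>, \<open>bcd\<close>,
      \<open>abd\<close>. Translation by \<open>x\<close> makes the third one start at
      \<open>b\<close>, so it is the face opposite \<open>q\<close>.\<close>
    have "flux E B q (inv\<^bsub>G\<^esub> x \<otimes>\<^bsub>G\<^esub> q) (inv\<^bsub>G\<^esub> y \<otimes>\<^bsub>G\<^esub> inv\<^bsub>G\<^esub> x \<otimes>\<^bsub>G\<^esub> q) +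
        flux E B q (inv\<^bsub>G\<^esub> (x \<otimes>\<^bsub>G\<^esub> y) \<otimes>\<^bsub>G\<^esub> q) (inv\<^bsub>G\<^esub> z \<otimes>\<^bsub>G\<^esub> inv\<^bsub>G\<^esub> (x \<otimes>\<^bsub>G\<^esub> y) \<otimes>\<^bsub>G\<^esub> q) =
        flux E B (inv\<^bsub>G\<^esub> x \<otimes>\<^bsub>G\<^esub> q) (inv\<^bsub>G\<^esub> y \<otimes>\<^bsub>G\<^esub> (inv\<^bsub>G\<^esub> x \<otimes>\<^bsub>G\<^esub> q))
          (inv\<^bsub>G\<^esub> z \<otimes>\<^bsub>G\<^esub> inv\<^bsub>G\<^esub> y \<otimes>\<^bsub>G\<^esub> (inv\<^bsub>G\<^esub> x \<otimes>\<^bsub>G\<^esub> q)) +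
        flux E B q (inv\<^bsub>G\<^esub> x \<otimes>\<^bsub>G\<^esub> q) (inv\<^bsub>G\<^esub> (y \<otimes>\<^bsub>G\<^esub> z) \<otimes>\<^bsub>G\<^esub> inv\<^bsub>G\<^esub> x \<otimes>\<^bsub>G\<^esub> q)"
      if "q \<in> carrier G" for q
      using that \<open>x \<in> carrier G\<close> \<open>y \<in> carrier G\<close> \<open>z \<in> carrier G\<close>
        tetrahedron_flux[OF B closed, of "?log q" "?log (inv\<^bsub>G\<^esub> x \<otimes>\<^bsub>G\<^esub> q)"
          "?log (inv\<^bsub>G\<^esub> y \<otimes>\<^bsub>G\<^esub> (inv\<^bsub>G\<^esub> x \<otimes>\<^bsub>G\<^esub> q))"
          "?log (inv\<^bsub>G\<^esub> z \<otimes>\<^bsub>G\<^esub> (inv\<^bsub>G\<^esub> y \<otimes>\<^bsub>G\<^esub> (inv\<^bsub>G\<^esub> x \<otimes>\<^bsub>G\<^esub> q)))"]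
      by (simp add: flux inv_mult_group m_assoc)
    then show ?thesis
      using that by (auto simp: circle_functions_def left_translate_def magnetic_cocycle_def
        fun_eq_iff restrict_def mult_exp_exp simp flip: distrib_left of_real_add)
  qed
  moreover have "magnetic_cocycle G E B (inv\<^bsub>G\<^esub> x) x = \<one>\<^bsub>circle_functions G\<^esub> \<and>
      magnetic_cocycle G E B x (inv\<^bsub>G\<^esub> x) = \<one>\<^bsub>circle_functions G\<^esub>" if x: "x \<in> carrier G" for x
  proof -
    \<comment> \<open>For mutually inverse arguments the third vertex is \<open>q\<close> again, so
      the second vector fed to \<open>B\<close> is zero.\<close>
    have "flux E B x y x = 0" for x y
      by (simp add: flux_def Let_def)
    then show ?thesis
      using x by (auto simp: magnetic_cocycle_def circle_functions_def fun_eq_iff restrict_def)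
  qed
  ultimately show ?thesis
    using continuous by (simp add: two_cocycle_def)
qed

end
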